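(* Let $D$ be a finite $3$-semi-symmetric digraph. If no two distinct lonely arcs of $D$ have a common endvertex, then $D$ is $\alpha$-diperfect.
   Context: Digraphs have no loops and no parallel arcs, but may contain both arcs $uv$ and $vu$ (cycles of length two). Two vertices $u,v$ are adjacent if $uv$ or $vu$ is an arc. An arc $uv$ of $D$ is lonely if $vu\notin A(D)$. A digraph is $k$-semi-symmetric if it has at most $k$ lonely arcs. A stable set is a set of pairwise non-adjacent vertices; it is maximum if no stable set has larger cardinality. A path of $D$ is a directed path, i.e. a sequence $v_1v_2\cdots v_\ell$ of distinct vertices ($\ell\ge 1$) with $v_iv_{i+1}\in A(D)$ for $1\le i<\ell$. A path partition of $D$ is a collection of paths whose vertex sets partition $V(D)$. For a stable set $S$, an $S$-path partition of $D$ is a path partition $\mathcal P$ with $|V(P)\cap S|=1$ for all $P\in\mathcal P$. A digraph satisfies the $\alpha$-property if it has an $S$-path partition for every maximum stable set $S$. A digraph is $\alpha$-diperfect if every induced subdigraph of it satisfies the $\alpha$-property. *)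

theory Defs
  imports "Graph_Theory.Digraph_Component" "Graph_Theory.Vertex_Walk" "HOL-Library.Disjoint_Sets"
begin

text \<open>
  The locale predicate \<open>digraph\<close> of the library means a finite digraph without loops and without
  parallel arcs; a pair of opposite arcs is allowed, and so is the null digraph.
\<close>

definition adjacent :: "('a, 'b) pre_digraph \<Rightarrow> 'a \<Rightarrow> 'a \<Rightarrow> bool" where
  "adjacent G u v \<longleftrightarrow> u \<rightarrow>\<^bsub>G\<^esub> v \<or> v \<rightarrow>\<^bsub>G\<^esub> u"

definition lonely_arcs :: "('a, 'b) pre_digraph \<Rightarrow> 'b set" where
  "lonely_arcs G = {e \<in> arcs G. \<not> head G e \<rightarrow>\<^bsub>G\<^esub> tail G e}"

definition semi_symmetric :: "nat \<Rightarrow> ('a, 'b) pre_digraph \<Rightarrow> bool" where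
  "semi_symmetric k G \<longleftrightarrow> finite (lonely_arcs G) \<and> card (lonely_arcs G) \<le> k"

definition stable_set :: "('a, 'b) pre_digraph \<Rightarrow> 'a set \<Rightarrow> bool" where
  "stable_set G S \<longleftrightarrow> S \<subseteq> verts G \<and> (\<forall>u\<in>S. \<forall>v\<in>S. u \<noteq> v \<longrightarrow> \<not> adjacent G u v)"

text \<open>Cardinalities are compared with \<^const>\<open>card\<close>, so this is meant for finite digraphs only.\<close>

definition maximum_stable_set :: "('a, 'b) pre_digraph \<Rightarrow> 'a set \<Rightarrow> bool" where
  "maximum_stable_set G S \<longleftrightarrow> stable_set G S \<and> (\<forall>T. stable_set G T \<longrightarrow> card T \<le> card S)"

text \<open>
  A path is given by its list of vertices: \<^const>\<open>vpath\<close> requires a nonempty list of distinct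
  vertices in which consecutive vertices are joined by a forward arc.
\<close>

definition path_partition :: "('a, 'b) pre_digraph \<Rightarrow> 'a list set \<Rightarrow> bool" where
  "path_partition G \<P> \<longleftrightarrow>
     (\<forall>p\<in>\<P>. vpath p G) \<and> disjoint_family_on set \<P> \<and> (\<Union>p\<in>\<P>. set p) = verts G"

definition S_path_partition :: "('a, 'b) pre_digraph \<Rightarrow> 'a set \<Rightarrow> 'a list set \<Rightarrow> bool" where
  "S_path_partition G S \<P> \<longleftrightarrow> path_partition G \<P> \<and> (\<forall>p\<in>\<P>. card (set p \<inter> S) = 1)"

definition alpha_property :: "('a, 'b) pre_digraph \<Rightarrow> bool" where
  "alpha_property G \<longleftrightarrow> (\<forall>S. maximum_stable_set G S \<longrightarrow> (\<exists>\<P>. S_path_partition G S \<P>))"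

definition alpha_diperfect :: "('a, 'b) pre_digraph \<Rightarrow> bool" where
  "alpha_diperfect G \<longleftrightarrow> (\<forall>H. induced_subgraph H G \<longrightarrow> alpha_property H)"

end

theory Submission
  imports Defs
begin

text \<open>
  Let \<open>S\<close> be a maximum stable set. The engine is the Gallai--Milgram theorem: a finite digraph has a
  path partition with at most as many paths as some stable set has vertices. It is applied to an
  auxiliary digraph in which no arc enters \<open>S\<close>. A path of the auxiliary digraph then meets \<open>S\<close> at
  most in its first vertex, so at least \<open>card S\<close> paths are needed to cover \<open>S\<close>, and if there are no
  more than that, every path meets \<open>S\<close> exactly once.

  If no lonely arc enters \<open>S\<close>, deleting all arcs that enter \<open>S\<close> changes no adjacency, so stable sets
  do not grow and the argument above finishes the proof
  (\<open>orthogonal_cover_if_no_lonely_arc_enters\<close>). Reversing all arcs settles the case that no lonely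
  arc leaves \<open>S\<close>.

  Otherwise a lonely arc enters \<open>S\<close> and another one leaves it. As there are at most three lonely arcs,
  at most one of them avoids \<open>S\<close>. Delete that arc, and make every edge between \<open>S\<close> and its
  complement an arc directed away from \<open>S\<close>, even if this reverses a lonely arc. Only one pair of
  vertices loses its adjacency, so a stable set of the auxiliary digraph has at most \<open>card S + 1\<close>
  vertices, and Gallai--Milgram gives one path from each vertex of \<open>S\<close> and at most one more path
  \<open>R\<close>, which avoids \<open>S\<close>. Since \<open>S\<close> is a maximal stable set, the first vertex of \<open>R\<close> is adjacent to
  some vertex of \<open>S\<close>, and \<open>R\<close> is attached there. Every vertex \<open>s\<close> of \<open>S\<close> is now the centre of at
  most two branches, which consist of symmetric arcs outside \<open>S\<close> and can therefore be traversed in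
  either direction. Because the lonely arcs form a matching, at most one of the two edges at \<open>s\<close> is
  lonely; its direction decides which branch is run through before \<open>s\<close> and which one after \<open>s\<close>
  (\<open>join_branches\<close>), and the two branches become one path through \<open>s\<close>.
\<close>

section \<open>Path covers and the Gallai--Milgram theorem\<close>

text \<open>
  The combinatorics takes place on a set of vertices with an arbitrary binary relation, which makes
  it easy to delete, reverse and reorient arcs.
\<close>

definition independent :: "('a \<Rightarrow> 'a \<Rightarrow> bool) \<Rightarrow> 'a set \<Rightarrow> bool" where
  "independent E T \<longleftrightarrow> (\<forall>u\<in>T. \<forall>v\<in>T. u \<noteq> v \<longrightarrow> \<not> E u v)"

definition path_cover :: "('a \<Rightarrow> 'a \<Rightarrow> bool) \<Rightarrow> 'a set \<Rightarrow> 'a list set \<Rightarrow> bool" where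
  "path_cover E V P \<longleftrightarrow>
     (\<forall>p\<in>P. p \<noteq> [] \<and> distinct p \<and> successively E p) \<and> disjoint_family_on set P \<and> (\<Union>p\<in>P. set p) = V"

lemma path_coverD:
  assumes "path_cover E V P" "p \<in> P"
  shows "p \<noteq> []" "distinct p" "successively E p" "set p \<subseteq> V" "hd p \<in> set p"
  using assms by (auto simp: path_cover_def)

lemma path_cover_disjoint:
  assumes "path_cover E V P" "p \<in> P" "q \<in> P" "x \<in> set p" "x \<in> set q"
  shows "p = q"
  using assms unfolding path_cover_def disjoint_family_on_def by blast

lemma inj_on_hd_path_cover:
  assumes "path_cover E V P"
  shows "inj_on hd P"
  by (metis assms inj_onI path_coverD(5) path_cover_disjoint)

lemma path_cover_mono:
  assumes "path_cover F V P" "\<And>u v. F u v \<Longrightarrow> E u v"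
  shows "path_cover E V P"
proof -
  have "successively E p" if "successively F p" for p
    using that by (rule successively_mono) (rule assms(2))
  then show ?thesis using assms(1) unfolding path_cover_def by simp
qed

lemma path_cover_add_singleton:
  assumes "path_cover E V P" "u \<notin> V"
  shows "path_cover E (insert u V) (insert [u] P)"
  using assms by (auto simp: path_cover_def disjoint_family_on_def)

lemma path_cover_remove_path:
  assumes "path_cover E V P" "p \<in> P"
  shows "path_cover E (V - set p) (P - {p})"
  using assms unfolding path_cover_def disjoint_family_on_def by blast

lemma path_cover_insert_path:
  assumes "path_cover E V P" "set p \<inter> V = {}" "p \<noteq> []" "distinct p" "successively E p"
  shows "path_cover E (V \<union> set p) (insert p P)"
  using assms unfolding path_cover_def disjoint_family_on_def by blast

text \<open>
  The proof of Gallai--Milgram minimizes the set of first vertices of a path cover. The next two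
  lemmas record how it changes when a vertex is put in front of a path or taken away from it.
\<close>

lemma path_cover_prepend:
  assumes P: "path_cover E V P" and q: "q \<in> P" and u: "u \<notin> V" and e: "E u (hd q)"
  obtains Q where "path_cover E (insert u V) Q" "hd ` Q = insert u (hd ` P - {hd q})"
proof
  let ?Q = "insert (u # q) (P - {q})"
  have "path_cover E (V - set q \<union> set (u # q)) ?Q"
    using path_coverD[OF P q] u e path_cover_remove_path[OF P q]
    by (intro path_cover_insert_path) (auto simp: successively_Cons)
  moreover have "V - set q \<union> set (u # q) = insert u V"
    using path_coverD(4)[OF P q] by auto
  ultimately show "path_cover E (insert u V) ?Q" by simp
  have "hd ` (P - {q}) = hd ` P - hd ` {q}"
    using inj_on_image_set_diff[OF inj_on_hd_path_cover[OF P], of P "{q}"] q by simp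
  then show "hd ` ?Q = insert u (hd ` P - {hd q})" by simp
qed

lemma path_cover_behead:
  assumes P: "path_cover E V P" and q: "u # q \<in> P" "q \<noteq> []"
  obtains Q where "path_cover E (V - {u}) Q" "hd ` Q = insert (hd q) (hd ` P - {u})" "card Q = card P"
proof
  let ?Q = "insert q (P - {u # q})"
  have "path_cover E (V - set (u # q) \<union> set q) ?Q"
    using path_coverD[OF P q(1)] path_cover_remove_path[OF P q(1)] q(2)
    by (intro path_cover_insert_path) (auto simp: successively_Cons)
  moreover have "V - set (u # q) \<union> set q = V - {u}"
    using path_coverD(2,4)[OF P q(1)] by auto
  ultimately show Q: "path_cover E (V - {u}) ?Q" by simp
  have "hd ` (P - {u # q}) = hd ` P - hd ` {u # q}"
    using inj_on_image_set_diff[OF inj_on_hd_path_cover[OF P], of P "{u # q}"] q by simp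
  then show "hd ` ?Q = insert (hd q) (hd ` P - {u})" by simp
  have "q \<notin> P - {u # q}"
    using path_cover_disjoint[OF P _ q(1)] q(2) by (metis DiffE insertI1 list.set_intros(2) list.set_sel(1))
  then show "card ?Q = card P"
    using q(1) by (metis card.infinite card.insert card.remove finite_Diff2 finite_insert finite.emptyI)
qed

text \<open>
  Minimality with respect to inclusion, rather than to the number of paths, is what makes the
  induction work. If the first vertices are not independent, some arc leads from the first vertex
  \<open>u\<close> of one path to the first vertex \<open>v\<close> of another. Cutting \<open>u\<close> off its path leaves a cover of
  \<open>V - {u}\<close> that is again minimal and has the same number of paths: \<open>u\<close> can be put back into any
  smaller cover of \<open>V - {u}\<close>, and the result would be a smaller cover of \<open>V\<close>.
\<close>

lemma gallai_milgram_minimal: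
  assumes "finite V" "path_cover E V P" "\<And>Q. path_cover E V Q \<Longrightarrow> \<not> hd ` Q \<subset> hd ` P"
  shows "\<exists>T\<subseteq>V. independent E T \<and> card T = card P"
  using assms
proof (induction V arbitrary: P rule: finite_psubset_induct)
  case (psubset V)
  note P = psubset.prems(1) and min = psubset.prems(2)
  have hdV: "hd ` P \<subseteq> V"
    using path_coverD(4,5)[OF P] by blast
  show ?case
  proof (cases "independent E (hd ` P)")
    case True
    then show ?thesis
      using hdV card_image[OF inj_on_hd_path_cover[OF P]] by blast
  next
    case False
    then obtain pu pv where pu: "pu \<in> P" and pv: "pv \<in> P" and ne: "hd pu \<noteq> hd pv"
      and e: "E (hd pu) (hd pv)"
      unfolding independent_def by blast
    define u v where "u = hd pu" and "v = hd pv"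
    have vu: "v \<noteq> u" using ne u_def v_def by simp
    obtain q where puq: "pu = u # q"
      using path_coverD(1)[OF P pu] u_def by (cases pu) auto
    have uV: "u \<in> V" and vP: "v \<in> hd ` P" and uP: "u \<in> hd ` P"
      using hdV pu pv u_def v_def by auto
    have ins: "insert u (V - {u}) = V" using uV by blast
    have euv: "E u v" using e u_def v_def by simp
    have put_back: "\<exists>Q. path_cover E V Q \<and> hd ` Q = insert u (hd ` R - {hd r})"
      if R: "path_cover E (V - {u}) R" "r \<in> R" "E u (hd r)" for R r
    proof -
      have "u \<notin> V - {u}" by simp
      then obtain Q where "path_cover E (insert u (V - {u})) Q" "hd ` Q = insert u (hd ` R - {hd r})"
        by (rule path_cover_prepend[OF R(1,2) _ R(3)])
      then show ?thesis unfolding ins by (intro exI conjI)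
    qed
    \<comment> \<open>If \<open>u\<close> were a path by itself, it could be put in front of the path that starts with \<open>v\<close>.\<close>
    have q: "q \<noteq> []"
    proof
      assume "q = []"
      then have "path_cover E (V - {u}) (P - {pu})"
        using path_cover_remove_path[OF P pu] puq by simp
      moreover have "pv \<in> P - {pu}" using pv ne by auto
      ultimately have "\<exists>Q. path_cover E V Q \<and> hd ` Q = insert u (hd ` (P - {pu}) - {v})"
        using put_back[of "P - {pu}" pv, folded v_def] euv by simp
      then obtain Q where Q: "path_cover E V Q" "hd ` Q = insert u (hd ` (P - {pu}) - {v})"
        by (elim exE conjE)
      have "v \<notin> hd ` Q" unfolding Q(2) using vu by simp
      moreover have "hd ` Q \<subseteq> hd ` P" unfolding Q(2) using uP by blast
      ultimately have "hd ` Q \<subset> hd ` P" using vP by blast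
      then show False using min Q(1) by blast
    qed
    obtain P' where P': "path_cover E (V - {u}) P'" "hd ` P' = insert (hd q) (hd ` P - {u})"
      "card P' = card P"
      using path_cover_behead[OF P pu[unfolded puq] q] .
    have "\<not> hd ` Q \<subset> hd ` P'" if Q: "path_cover E (V - {u}) Q" for Q
    proof
      assume "hd ` Q \<subset> hd ` P'"
      then obtain w where "hd ` Q \<subseteq> insert (hd q) (hd ` P - {u})"
        and "w \<in> insert (hd q) (hd ` P - {u})" "w \<notin> hd ` Q"
        unfolding P'(2) psubset_eq by blast
      moreover define A B where "A = hd ` P" and "B = hd ` Q"
      ultimately have AB: "B \<subseteq> insert (hd q) (A - {u})" "w \<in> insert (hd q) (A - {u})" "w \<notin> B"
        "u \<in> A" "v \<in> A"
        using uP vP by simp_all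
      \<comment> \<open>Put \<open>u\<close> back in front of its former successor if possible, otherwise in front of \<open>v\<close>; if
        neither starts a path of \<open>Q\<close>, then \<open>u\<close> as a new path is compensated by the loss of \<open>v\<close>.\<close>
      have "\<exists>Q'. path_cover E V Q' \<and> hd ` Q' \<subset> hd ` P"
      proof (cases "hd q \<in> hd ` Q")
        case True
        then obtain r where r: "r \<in> Q" "hd r = hd q" by force
        have "E u (hd r)"
          using path_coverD(3)[OF P pu] q unfolding puq r(2) by (simp add: successively_Cons)
        from put_back[OF Q r(1) this, unfolded r(2)] obtain Q'
          where Q': "path_cover E V Q'" "hd ` Q' = insert u (hd ` Q - {hd q})"
          by (elim exE conjE)
        have "hd ` Q' \<subset> hd ` P"
          using AB True unfolding Q'(2) A_def[symmetric] B_def[symmetric] by blast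
        then show ?thesis using Q' by blast
      next
        case nq: False
        show ?thesis
        proof (cases "v \<in> hd ` Q")
          case True
          then obtain r where r: "r \<in> Q" "hd r = v" by force
          from put_back[OF Q r(1), unfolded r(2), OF euv] obtain Q'
            where Q': "path_cover E V Q'" "hd ` Q' = insert u (hd ` Q - {v})"
            by (elim exE conjE)
          have "hd ` Q' \<subset> hd ` P"
            using AB nq vu unfolding Q'(2) A_def[symmetric] B_def[symmetric] by blast
          then show ?thesis using Q'(1) by blast
        next
          case False
          have "path_cover E V (insert [u] Q)"
            using path_cover_add_singleton[OF Q, of u] ins by auto
          moreover have "hd ` insert [u] Q \<subset> hd ` P"
            using AB nq vu False unfolding image_insert list.sel A_def[symmetric] B_def[symmetric]
            by blast
          ultimately show ?thesis by blast
        qed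
      qed
      then show False using min by blast
    qed
    then obtain T where "T \<subseteq> V - {u}" "independent E T" "card T = card P'"
      using psubset.IH[of "V - {u}" P'] P'(1) uV by blast
    then show ?thesis using P'(3) by auto
  qed
qed

theorem gallai_milgram:
  assumes "finite V"
  obtains P T where "path_cover E V P" "T \<subseteq> V" "independent E T" "card P = card T"
proof -
  have "path_cover E V ((\<lambda>v. [v]) ` V)"
    by (auto simp: path_cover_def disjoint_family_on_def)
  then obtain P where P: "path_cover E V P"
    and min: "\<And>Q. path_cover E V Q \<Longrightarrow> card (hd ` P) \<le> card (hd ` Q)"
    using ex_has_least_nat[of "path_cover E V" _ "\<lambda>P. card (hd ` P)"] by blast
  have "finite (hd ` P)"
    using path_coverD(4,5)[OF P] assms by (meson finite_subset image_subsetI subsetD)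
  then have "\<not> hd ` Q \<subset> hd ` P" if "path_cover E V Q" for Q
    using min[OF that] psubset_card_mono by (metis leD)
  then show ?thesis
    using gallai_milgram_minimal[OF assms P] P that by metis
qed

section \<open>Covers by paths that meet a maximum independent set once\<close>

lemma path_cover_rev:
  assumes "path_cover (\<lambda>u v. E v u) V P"
  shows "path_cover E V (rev ` P)"
  using assms by (auto simp: path_cover_def disjoint_family_on_def)

lemma independent_converse: "independent (\<lambda>u v. E v u) T \<longleftrightarrow> independent E T"
  unfolding independent_def by auto

lemma successively_avoids:
  assumes "successively F (x # xs)" "\<And>u v. F u v \<Longrightarrow> v \<notin> S"
  shows "set xs \<inter> S = {}"
  using assms by (induction xs arbitrary: x) auto

text \<open>
  When no arc enters \<open>S\<close>, only the first vertex of a path can belong to \<open>S\<close>, and hence every vertex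
  of \<open>S\<close> starts its own path.
\<close>

lemma path_inter_source_set:
  assumes "path_cover F V P" "p \<in> P" "\<forall>u v. F u v \<longrightarrow> v \<notin> S"
  shows "set p \<inter> S \<subseteq> {hd p}"
proof (cases p)
  case (Cons x xs)
  then show ?thesis
    using successively_avoids[of F x xs S] path_coverD(3)[OF assms(1,2)] assms(3) by auto
qed simp

lemma hds_of_source_set:
  assumes "path_cover F V P" "\<forall>u v. F u v \<longrightarrow> v \<notin> S" "S \<subseteq> V"
  shows "S \<subseteq> hd ` P"
proof
  fix s assume "s \<in> S"
  then obtain p where "p \<in> P" "s \<in> set p"
    using assms(1,3) unfolding path_cover_def by blast
  then show "s \<in> hd ` P"
    using path_inter_source_set[of F V P p S] assms(1,2) \<open>s \<in> S\<close> by blast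
qed

text \<open>
  Arcs entering \<open>S\<close> are redundant for adjacency here, because their reversals are arcs as well. So
  they can be deleted without creating new independent sets.
\<close>

lemma orthogonal_cover_if_no_lonely_arc_enters:
  assumes fin: "finite V" and S: "S \<subseteq> V" "independent E S"
    and max: "\<forall>T\<subseteq>V. independent E T \<longrightarrow> card T \<le> card S"
    and no: "\<And>s v. s \<in> S \<Longrightarrow> v \<in> V - S \<Longrightarrow> E v s \<Longrightarrow> E s v"
  shows "\<exists>P. path_cover E V P \<and> (\<forall>p\<in>P. card (set p \<inter> S) = 1)"
proof -
  define F where "F u v \<longleftrightarrow> E u v \<and> v \<notin> S" for u v
  have F: "\<forall>u v. F u v \<longrightarrow> v \<notin> S" by (simp add: F_def)
  obtain P T where P: "path_cover F V P" and T: "T \<subseteq> V" "independent F T" "card P = card T"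
    using gallai_milgram[OF fin] .
  have "independent E T"
    unfolding independent_def
  proof (intro ballI impI notI)
    fix u v assume uv: "u \<in> T" "v \<in> T" "u \<noteq> v" "E u v"
    then have "\<not> F u v" "\<not> F v u" using T(2) unfolding independent_def by auto
    then show False
      using uv S no[of v u] T(1) unfolding F_def independent_def by blast
  qed
  then have "card P \<le> card S" using max T by simp
  moreover have "finite P"
  proof (rule inj_on_finite[OF inj_on_hd_path_cover[OF P] _ fin])
    show "hd ` P \<subseteq> V" using path_coverD(4,5)[OF P] by blast
  qed
  ultimately have "finite (hd ` P)" "card (hd ` P) \<le> card S"
    using card_image_le[of P hd] by auto
  then have hd: "hd ` P = S"
    using card_seteq[OF _ hds_of_source_set[OF P F S(1)]] by simp
  have "set p \<inter> S = {hd p}" if "p \<in> P" for p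
    using path_inter_source_set[OF P that F] path_coverD(5)[OF P that] hd that by blast
  moreover have "path_cover E V P"
    by (rule path_cover_mono[OF P]) (simp add: F_def)
  ultimately show ?thesis by (intro exI[of _ P]) simp
qed

lemma orthogonal_cover_if_no_lonely_arc_leaves:
  assumes "finite V" "S \<subseteq> V" "independent E S"
    and "\<forall>T\<subseteq>V. independent E T \<longrightarrow> card T \<le> card S"
    and "\<And>s v. s \<in> S \<Longrightarrow> v \<in> V - S \<Longrightarrow> E s v \<Longrightarrow> E v s"
  shows "\<exists>P. path_cover E V P \<and> (\<forall>p\<in>P. card (set p \<inter> S) = 1)"
proof -
  have "\<exists>P. path_cover (\<lambda>u v. E v u) V P \<and> (\<forall>p\<in>P. card (set p \<inter> S) = 1)"
    by (rule orthogonal_cover_if_no_lonely_arc_enters) (use assms in \<open>simp_all add: independent_converse[of E]\<close>)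
  then obtain P where P: "path_cover (\<lambda>u v. E v u) V P" "\<forall>p\<in>P. card (set p \<inter> S) = 1"
    by blast
  then show ?thesis
    using path_cover_rev[OF P(1)] by (intro exI[of _ "rev ` P"]) simp
qed

text \<open>
  A branch at \<open>s\<close> is a path of symmetric arcs whose first vertex is adjacent to \<open>s\<close>. It can be
  traversed towards \<open>s\<close> or away from \<open>s\<close>, subject only to the direction of the edge at \<open>s\<close>.
  An empty list stands for a missing branch.
\<close>

lemma join_branches_oriented:
  assumes "distinct (s # b @ c)"
    and "successively (\<lambda>u v. E u v \<and> E v u) b" "successively (\<lambda>u v. E u v \<and> E v u) c"
    and "b \<noteq> [] \<Longrightarrow> E (hd b) s" "c \<noteq> [] \<Longrightarrow> E s (hd c)"
  shows "\<exists>l. l \<noteq> [] \<and> distinct l \<and> successively E l \<and> set l = insert s (set b \<union> set c)"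
proof -
  have "successively (\<lambda>u v. E v u) b"
    by (rule successively_mono[OF assms(2)]) simp
  moreover have "successively E c"
    by (rule successively_mono[OF assms(3)]) simp
  ultimately have "successively E (rev b @ s # c)"
    using assms(4,5) by (auto simp: successively_append_iff successively_Cons last_rev)
  then show ?thesis
    using assms(1) by (intro exI[of _ "rev b @ s # c"]) auto
qed

text \<open>
  One of the two edges at \<open>s\<close> is symmetric, so the branch behind the other edge is put on the side
  of \<open>s\<close> that its direction dictates, and the symmetric one takes the remaining side.
\<close>

lemma join_branches:
  assumes "distinct (s # b @ c)"
    and "successively (\<lambda>u v. E u v \<and> E v u) b" "successively (\<lambda>u v. E u v \<and> E v u) c"
    and "b \<noteq> [] \<Longrightarrow> E (hd b) s \<or> E s (hd b)" "c \<noteq> [] \<Longrightarrow> E (hd c) s \<or> E s (hd c)"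
    and "b \<noteq> [] \<Longrightarrow> c \<noteq> [] \<Longrightarrow> (E (hd b) s \<and> E s (hd b)) \<or> (E (hd c) s \<and> E s (hd c))"
  shows "\<exists>l. l \<noteq> [] \<and> distinct l \<and> successively E l \<and> set l = insert s (set b \<union> set c)"
proof (cases "(b \<noteq> [] \<longrightarrow> E (hd b) s) \<and> (c \<noteq> [] \<longrightarrow> E s (hd c))")
  case True
  then show ?thesis using assms(1-3) by (intro join_branches_oriented) blast+
next
  case False
  then have *: "(c \<noteq> [] \<longrightarrow> E (hd c) s) \<and> (b \<noteq> [] \<longrightarrow> E s (hd b))"
    using assms(4,5,6) by blast
  have "\<exists>l. l \<noteq> [] \<and> distinct l \<and> successively E l \<and> set l = insert s (set c \<union> set b)"
  proof (rule join_branches_oriented)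
    show "distinct (s # c @ b)" using assms(1) by auto
  qed (use assms(2,3) * in blast)+
  then show ?thesis by (simp add: Un_commute)
qed

lemma orthogonal_cover_of_family:
  assumes "\<And>s. s \<in> S \<Longrightarrow> \<exists>l. l \<noteq> [] \<and> distinct l \<and> successively E l \<and> set l = A s"
    and "\<And>s. s \<in> S \<Longrightarrow> A s \<inter> S = {s}" and "disjoint_family_on A S" and "(\<Union>s\<in>S. A s) = V"
  shows "\<exists>P. path_cover E V P \<and> (\<forall>p\<in>P. card (set p \<inter> S) = 1)"
proof -
  have "\<forall>s\<in>S. \<exists>l. l \<noteq> [] \<and> distinct l \<and> successively E l \<and> set l = A s"
    using assms(1) by blast
  from bchoice[OF this] obtain l
    where l: "\<forall>s\<in>S. l s \<noteq> [] \<and> distinct (l s) \<and> successively E (l s) \<and> set (l s) = A s"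
    by (rule exE)
  then have "disjoint_family_on set (l ` S)"
    using assms(3) unfolding disjoint_family_on_def by force
  then have "path_cover E V (l ` S)"
    using l assms(4) unfolding path_cover_def by simp
  then show ?thesis
    using l assms(2) by (intro exI[of _ "l ` S"]) simp
qed

text \<open>
  All lonely arcs outside \<open>S\<close> are assumed to share their tail \<open>p\<close>: then an independent set of the
  digraph without these arcs becomes independent in \<open>E\<close> by removing \<open>p\<close>, so it exceeds \<open>S\<close> by at
  most one vertex and Gallai--Milgram produces at most one path that avoids \<open>S\<close>.
\<close>

lemma orthogonal_cover_if_one_lonely_arc_outside:
  assumes fin: "finite V" and S: "S \<subseteq> V" "independent E S"
    and max: "\<forall>T\<subseteq>V. independent E T \<longrightarrow> card T \<le> card S"
    and outside: "\<And>u v. u \<in> V - S \<Longrightarrow> v \<in> V - S \<Longrightarrow> E u v \<Longrightarrow> \<not> E v u \<Longrightarrow> u = p"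
    and matched: "\<And>s u v. s \<in> S \<Longrightarrow> u \<in> V - S \<Longrightarrow> v \<in> V - S \<Longrightarrow> u \<noteq> v \<Longrightarrow>
      E u s \<or> E s u \<Longrightarrow> E v s \<or> E s v \<Longrightarrow> (E u s \<and> E s u) \<or> (E v s \<and> E s v)"
  shows "\<exists>P. path_cover E V P \<and> (\<forall>p\<in>P. card (set p \<inter> S) = 1)"
proof -
  \<comment> \<open>Symmetric arcs outside \<open>S\<close>, and all edges at \<open>S\<close> directed away from \<open>S\<close>.\<close>
  define F where "F u v \<longleftrightarrow> v \<notin> S \<and> (if u \<in> S then E u v \<or> E v u else E u v \<and> E v u)" for u v
  have F: "\<forall>u v. F u v \<longrightarrow> v \<notin> S" by (simp add: F_def)
  obtain P T where P: "path_cover F V P" and T: "T \<subseteq> V" "independent F T" "card P = card T"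
    using gallai_milgram[OF fin] .
  have finS: "finite S" using fin S(1) finite_subset by blast
  have finP: "finite P"
  proof (rule inj_on_finite[OF inj_on_hd_path_cover[OF P] _ fin])
    show "hd ` P \<subseteq> V" using path_coverD(4,5)[OF P] by blast
  qed
  have "independent E (T - {p})"
    unfolding independent_def
  proof (intro ballI impI notI)
    fix u v assume uv: "u \<in> T - {p}" "v \<in> T - {p}" "u \<noteq> v" "E u v"
    then have "\<not> F u v" "\<not> F v u" using T(2) unfolding independent_def by auto
    then show False
      using uv S(2) outside[of u v] T(1) unfolding F_def independent_def by (auto split: if_splits)
  qed
  then have "card (T - {p}) \<le> card S" using max T(1) by blast
  then have cardP: "card P \<le> Suc (card S)"
    using T(3) by (simp add: card_Diff_singleton_if split: if_splits)
  \<comment> \<open>\<open>f s\<close> is the path of \<open>P\<close> that starts at \<open>s\<close>; at most one path of \<open>P\<close> is not of this form.\<close>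
  have "\<forall>s\<in>S. \<exists>q. q \<in> P \<and> hd q = s"
    using hds_of_source_set[OF P F S(1)] by blast
  then obtain f where "\<forall>s\<in>S. f s \<in> P \<and> hd (f s) = s"
    using bchoice[of S "\<lambda>s q. q \<in> P \<and> hd q = s"] by blast
  then have f: "\<And>s. s \<in> S \<Longrightarrow> f s \<in> P" "\<And>s. s \<in> S \<Longrightarrow> hd (f s) = s"
    by auto
  have injf: "inj_on f S" using f(2) by (metis inj_onI)
  have f_S: "set (f s) \<inter> S = {s}" "f s = s # tl (f s)" if "s \<in> S" for s
  proof -
    note fs = path_inter_source_set[OF P f(1)[OF that] F] path_coverD(1,5)[OF P f(1)[OF that]] f(2)[OF that]
    show "set (f s) \<inter> S = {s}" using fs(1,3,4) that by auto
    show "f s = s # tl (f s)" using fs(2,4) by (cases "f s") auto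
  qed
  have "card (P - f ` S) \<le> 1"
    using cardP f(1) by (subst card_Diff_subset) (auto simp: card_image[OF injf] finS)
  have avoid: "set q \<inter> S = {}" if "q \<in> P - f ` S" for q
  proof -
    have "False" if "s \<in> set q" "s \<in> S" for s
      using path_cover_disjoint[OF P _ f(1)[OF that(2)], of q s] f_S(1)[OF that(2)] that
        \<open>q \<in> P - f ` S\<close> by blast
    then show ?thesis by blast
  qed
  \<comment> \<open>A maximum independent set cannot be enlarged, so an extra path can be attached to it.\<close>
  have nbr: "\<exists>s\<in>S. E r s \<or> E s r" if "r \<in> V - S" for r
  proof (rule ccontr)
    assume "\<not> ?thesis"
    then have "independent E (insert r S)" using S(2) unfolding independent_def by auto
    then have "card (insert r S) \<le> card S" using max that S(1) by auto
    then show False using that finS by simp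
  qed
  \<comment> \<open>\<open>h s\<close> is the extra path if that path is attached to \<open>s\<close>, and empty otherwise.\<close>
  have "\<exists>h. (\<forall>s\<in>S. h s \<noteq> [] \<longrightarrow> h s \<in> P - f ` S \<and> (E (hd (h s)) s \<or> E s (hd (h s)))) \<and>
    (\<forall>s\<in>S. \<forall>t\<in>S. s \<noteq> t \<longrightarrow> set (h s) \<inter> set (h t) = {}) \<and> (\<Union>s\<in>S. set (f s) \<union> set (h s)) = V"
  proof (cases "P - f ` S = {}")
    case True
    then have "P = f ` S" using f(1) by auto
    then have "(\<Union>s\<in>S. set (f s)) = V" using P unfolding path_cover_def by auto
    then show ?thesis by (intro exI[of _ "\<lambda>_. []"]) simp
  next
    case False
    then have "card (P - f ` S) \<noteq> 0" using finP by simp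
    then have "card (P - f ` S) = 1" using \<open>card (P - f ` S) \<le> 1\<close> by linarith
    then obtain R where R: "P - f ` S = {R}" by (rule card_1_singletonE)
    then have RP: "R \<in> P" "set R \<inter> S = {}" using avoid by auto
    then obtain s0 where s0: "s0 \<in> S" "E (hd R) s0 \<or> E s0 (hd R)"
      using nbr[of "hd R"] path_coverD(4,5)[OF P RP(1)] by blast
    have "P = insert R (f ` S)" using R f(1) by blast
    then have "V = (\<Union>s\<in>S. set (f s)) \<union> set R" using P unfolding path_cover_def by auto
    then show ?thesis
      using R s0 by (intro exI[of _ "\<lambda>s. if s = s0 then R else []"]) auto
  qed
  then obtain h where h: "\<And>s. s \<in> S \<Longrightarrow> h s \<noteq> [] \<Longrightarrow> h s \<in> P - f ` S"
      "\<And>s. s \<in> S \<Longrightarrow> h s \<noteq> [] \<Longrightarrow> E (hd (h s)) s \<or> E s (hd (h s))"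
    and h_disj: "\<And>s t. s \<in> S \<Longrightarrow> t \<in> S \<Longrightarrow> s \<noteq> t \<Longrightarrow> set (h s) \<inter> set (h t) = {}"
    and V: "(\<Union>s\<in>S. set (f s) \<union> set (h s)) = V"
    by blast
  have fh: "set (f s) \<inter> set (h t) = {}" if "s \<in> S" "t \<in> S" for s t
  proof (cases "h t = []")
    case False
    then have "h t \<in> P" "f s \<noteq> h t" using h(1)[OF that(2)] that(1) by force+
    then show ?thesis
      using path_cover_disjoint[OF P f(1)[OF that(1)], of "h t"] by blast
  qed simp
  have ff: "set (f s) \<inter> set (f t) = {}" if "s \<in> S" "t \<in> S" "s \<noteq> t" for s t
  proof -
    have "f s \<noteq> f t" using injf that by (simp add: inj_on_eq_iff)
    then show ?thesis
      using path_cover_disjoint[OF P f(1)[OF that(1)] f(1)[OF that(2)]] by blast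
  qed
  have sym: "successively (\<lambda>u v. E u v \<and> E v u) b"
    if "successively F b" "set b \<inter> S = {}" for b
    using that by (induction b rule: induct_list012) (auto simp: F_def)
  have "\<exists>l. l \<noteq> [] \<and> distinct l \<and> successively E l \<and> set l = set (f s) \<union> set (h s)"
    if s: "s \<in> S" for s
  proof -
    define b where "b = tl (f s)"
    have fs: "f s = s # b" using f_S(2)[OF s] by (simp add: b_def)
    have set_fs: "set (f s) = insert s (set b)" using fs by simp
    have fsP: "distinct (s # b)" "successively F (s # b)"
      using path_coverD(2,3)[OF P f(1)[OF s]] unfolding fs by auto
    have bV: "set b \<subseteq> V - S"
      using path_coverD(4)[OF P f(1)[OF s]] f_S(1)[OF s] fsP(1) unfolding set_fs by auto
    have hV: "set (h s) \<subseteq> V - S" "distinct (h s)" "successively F (h s)"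
    proof (atomize (full), cases "h s = []")
      case False
      then have "h s \<in> P - f ` S" using h(1)[OF s] by blast
      then show "set (h s) \<subseteq> V - S \<and> distinct (h s) \<and> successively F (h s)"
        using path_coverD(2,3,4)[OF P, of "h s"] avoid[of "h s"] by blast
    qed simp
    have dist: "distinct (s # b @ h s)"
      using fsP(1) hV(2) fh[OF s s] unfolding set_fs by auto
    have succ: "successively (\<lambda>u v. E u v \<and> E v u) b" "successively (\<lambda>u v. E u v \<and> E v u) (h s)"
      using sym[of b] sym[of "h s"] fsP(2) bV hV by (auto simp: successively_Cons)
    have b1: "E (hd b) s \<or> E s (hd b)" if "b \<noteq> []"
      using fsP(2) that s by (auto simp: successively_Cons F_def)
    have one_sym: "(E (hd b) s \<and> E s (hd b)) \<or> (E (hd (h s)) s \<and> E s (hd (h s)))"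
      if ne: "b \<noteq> []" "h s \<noteq> []"
    proof (rule matched[OF s])
      have "hd b \<in> set b" "hd (h s) \<in> set (h s)" using ne by auto
      then show "hd b \<in> V - S" "hd (h s) \<in> V - S" "hd b \<noteq> hd (h s)"
        using bV hV(1) fh[OF s s] unfolding set_fs by auto
    qed (use b1 h(2)[OF s] ne in auto)
    have "\<exists>l. l \<noteq> [] \<and> distinct l \<and> successively E l \<and> set l = insert s (set b \<union> set (h s))"
      by (rule join_branches[OF dist succ]) (fact b1 h(2)[OF s] one_sym)+
    then show ?thesis unfolding set_fs by simp
  qed
  moreover have "(set (f s) \<union> set (h s)) \<inter> S = {s}" if "s \<in> S" for s
  proof -
    have "set (h s) \<inter> S = {}" using h(1)[OF that] avoid by (cases "h s = []") auto
    then show ?thesis using f_S(1)[OF that] by (simp add: Int_Un_distrib2)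
  qed
  moreover have "disjoint_family_on (\<lambda>s. set (f s) \<union> set (h s)) S"
    unfolding disjoint_family_on_def
  proof (intro ballI impI)
    fix s t assume "s \<in> S" "t \<in> S" "s \<noteq> t"
    then show "(set (f s) \<union> set (h s)) \<inter> (set (f t) \<union> set (h t)) = {}"
      using ff[of s t] fh[of s t] fh[of t s] h_disj[of s t] by blast
  qed
  ultimately show ?thesis
    using V by (intro orthogonal_cover_of_family[where A = "\<lambda>s. set (f s) \<union> set (h s)"]) blast+
qed

text \<open>
  The bound three enters here: once a lonely arc enters \<open>S\<close> and another one leaves it, at most one
  is left for the complement of \<open>S\<close>. That \<open>L\<close> is a matching means that no vertex of \<open>S\<close> has lonely
  arcs to two different branches.
\<close>

lemma orthogonal_cover_of_lonely_matching:
  fixes E :: "'a \<Rightarrow> 'a \<Rightarrow> bool"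
  assumes fin: "finite V" and S: "S \<subseteq> V" "independent E S"
    and max: "\<forall>T\<subseteq>V. independent E T \<longrightarrow> card T \<le> card S"
    and L: "finite L" "card L \<le> 3" "\<And>u v. u \<in> V \<Longrightarrow> v \<in> V \<Longrightarrow> E u v \<Longrightarrow> \<not> E v u \<Longrightarrow> (u, v) \<in> L"
    and matching: "\<And>u v u' v'. (u, v) \<in> L \<Longrightarrow> (u', v') \<in> L \<Longrightarrow> (u, v) \<noteq> (u', v') \<Longrightarrow> {u, v} \<inter> {u', v'} = {}"
  shows "\<exists>P. path_cover E V P \<and> (\<forall>p\<in>P. card (set p \<inter> S) = 1)"
proof -
  consider (no_entering) "\<And>s v. s \<in> S \<Longrightarrow> v \<in> V - S \<Longrightarrow> E v s \<Longrightarrow> E s v"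
    | (no_leaving) "\<And>s v. s \<in> S \<Longrightarrow> v \<in> V - S \<Longrightarrow> E s v \<Longrightarrow> E v s"
    | (both) s x t y where "s \<in> S" "x \<in> V - S" "E x s" "\<not> E s x" "t \<in> S" "y \<in> V - S" "E t y" "\<not> E y t"
    by blast
  then show ?thesis
  proof cases
    case no_entering
    then show ?thesis using orthogonal_cover_if_no_lonely_arc_enters[OF fin S max] by blast
  next
    case no_leaving
    then show ?thesis using orthogonal_cover_if_no_lonely_arc_leaves[OF fin S max] by blast
  next
    case both
    define C where "C = L \<inter> (V - S) \<times> (V - S)"
    have "(x, s) \<in> L" "(t, y) \<in> L" using both S(1) L(3) by blast+
    then have "C \<subseteq> L - {(x, s), (t, y)}" "(x, s) \<noteq> (t, y)" using both unfolding C_def by auto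
    then have "card C \<le> card (L - {(x, s), (t, y)})" "card {(x, s), (t, y)} = 2"
      using L(1) by (auto intro: card_mono)
    then have "card C \<le> 1"
      using L(2) \<open>(x, s) \<in> L\<close> \<open>(t, y) \<in> L\<close> by (simp add: card_Diff_subset)
    moreover have "finite C" using L(1) C_def by simp
    ultimately obtain p where "\<And>c. c \<in> C \<Longrightarrow> fst c = p"
      by (metis One_nat_def card_le_Suc0_iff_eq)
    then have outside: "u = p" if "u \<in> V - S" "v \<in> V - S" "E u v" "\<not> E v u" for u v
      using that L(3)[of u v] unfolding C_def by fastforce
    show ?thesis
    proof (rule orthogonal_cover_if_one_lonely_arc_outside[OF fin S max])
      show "u = p" if "u \<in> V - S" "v \<in> V - S" "E u v" "\<not> E v u" for u v
        using that by (rule outside)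
    next
      fix s u v assume *: "s \<in> S" "u \<in> V - S" "v \<in> V - S" "u \<noteq> v" "E u s \<or> E s u" "E v s \<or> E s v"
      show "(E u s \<and> E s u) \<or> (E v s \<and> E s v)"
      proof (rule ccontr)
        assume "\<not> ?thesis"
        then have "(s, u) \<in> L \<or> (u, s) \<in> L" "(s, v) \<in> L \<or> (v, s) \<in> L"
          using * S(1) L(3)[of s u] L(3)[of u s] L(3)[of s v] L(3)[of v s] by auto
        then show False using matching * by blast
      qed
    qed
  qed
qed

section \<open>Digraphs whose lonely arcs form a matching\<close>

lemma vpath_iff_successively:
  "vpath p G \<longleftrightarrow> p \<noteq> [] \<and> distinct p \<and> set p \<subseteq> verts G \<and> successively (\<lambda>u v. u \<rightarrow>\<^bsub>G\<^esub> v) p"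
proof -
  have "set (vwalk_arcs p) \<subseteq> arcs_ends G \<longleftrightarrow> successively (\<lambda>u v. u \<rightarrow>\<^bsub>G\<^esub> v) p"
    by (induction p rule: vwalk_arcs.induct) auto
  then show ?thesis by (auto simp: vpath_def vwalk_def)
qed

lemma path_cover_imp_path_partition:
  assumes "path_cover (\<lambda>u v. u \<rightarrow>\<^bsub>G\<^esub> v) (verts G) P"
  shows "path_partition G P"
  using assms by (auto simp: path_cover_def path_partition_def vpath_iff_successively)

lemma stable_set_iff_independent:
  "stable_set G T \<longleftrightarrow> T \<subseteq> verts G \<and> independent (\<lambda>u v. u \<rightarrow>\<^bsub>G\<^esub> v) T"
  unfolding stable_set_def independent_def adjacent_def by auto

text \<open>
  In particular an arc of an induced subdigraph is lonely there only if it is lonely in the whole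
  digraph, so the hypotheses on lonely arcs are inherited.
\<close>

lemma dominates_induced_subgraph:
  assumes "induced_subgraph H G"
  shows "u \<rightarrow>\<^bsub>H\<^esub> v \<longleftrightarrow> u \<rightarrow>\<^bsub>G\<^esub> v \<and> u \<in> verts H \<and> v \<in> verts H"
proof -
  have "tail H = tail G" "head H = head G"
    using assms unfolding induced_subgraph_def subgraph_def compatible_def by simp_all
  moreover have "arcs H = {e \<in> arcs G. tail G e \<in> verts H \<and> head G e \<in> verts H}"
    using assms unfolding induced_subgraph_def by blast
  ultimately show ?thesis
    unfolding arcs_ends_def arc_to_ends_def by (simp add: image_iff) blast
qed

lemma lonely_arcs_ends:
  "(\<lambda>e. (tail G e, head G e)) ` lonely_arcs G = {(u, v). u \<rightarrow>\<^bsub>G\<^esub> v \<and> \<not> v \<rightarrow>\<^bsub>G\<^esub> u}"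
  by (auto simp: lonely_arcs_def arcs_ends_def arc_to_ends_def image_iff)

theorem corollary7p6:
  fixes D :: "('a, 'b) pre_digraph"
  assumes "digraph D"
    and "semi_symmetric 3 D"
    and "\<And>e f. e \<in> lonely_arcs D \<Longrightarrow> f \<in> lonely_arcs D \<Longrightarrow> e \<noteq> f \<Longrightarrow>
           {tail D e, head D e} \<inter> {tail D f, head D f} = {}"
  shows "alpha_diperfect D"
  unfolding alpha_diperfect_def alpha_property_def
proof (intro allI impI)
  fix H :: "('a, 'b) pre_digraph" and S
  assume H: "induced_subgraph H D" and S: "maximum_stable_set H S"
  let ?E = "\<lambda>u v. u \<rightarrow>\<^bsub>H\<^esub> v"
  define L where "L = (\<lambda>e. (tail D e, head D e)) ` lonely_arcs D"
  note L_iff = lonely_arcs_ends[of D, folded L_def]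
  interpret D: digraph D by fact
  have "\<exists>P. path_cover ?E (verts H) P \<and> (\<forall>p\<in>P. card (set p \<inter> S) = 1)"
  proof (rule orthogonal_cover_of_lonely_matching[where L = L])
    have "verts H \<subseteq> verts D" using H by (auto simp: induced_subgraph_def subgraph_def)
    then show "finite (verts H)" using D.finite_verts finite_subset by blast
    show "S \<subseteq> verts H" "independent ?E S"
      "\<forall>T\<subseteq>verts H. independent ?E T \<longrightarrow> card T \<le> card S"
      using S unfolding maximum_stable_set_def stable_set_iff_independent by auto
    show "finite L" "card L \<le> 3"
      using assms(2) unfolding semi_symmetric_def L_def by (auto intro: card_image_le[THEN le_trans])
    show "(u, v) \<in> L" if "u \<in> verts H" "v \<in> verts H" "u \<rightarrow>\<^bsub>H\<^esub> v" "\<not> v \<rightarrow>\<^bsub>H\<^esub> u" for u v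
      using that dominates_induced_subgraph[OF H] L_iff by auto
    show "{u, v} \<inter> {u', v'} = {}"
      if uv: "(u, v) \<in> L" "(u', v') \<in> L" "(u, v) \<noteq> (u', v')" for u v u' v'
    proof -
      obtain e f where "e \<in> lonely_arcs D" "f \<in> lonely_arcs D"
        "(u, v) = (tail D e, head D e)" "(u', v') = (tail D f, head D f)"
        using uv(1,2) unfolding L_def by blast
      then show ?thesis using assms(3)[of e f] uv(3) by auto
    qed
  qed
  then show "\<exists>\<P>. S_path_partition H S \<P>"
    using path_cover_imp_path_partition unfolding S_path_partition_def by blast
qed

end
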